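(* Let $A\in\mathbb{R}^{m\times n}$ and $1\le k\le\operatorname{rank}(A)$. Let $P\in\mathbb{R}^{n\times n}$ be a permutation matrix and consider a partial QR factorization $$AP=\begin{bmatrix}Q_1&Q_2\end{bmatrix}\begin{bmatrix}R_{11}&R_{12}\\0&R_{22}\end{bmatrix},$$ where $Q_1\in\mathbb{R}^{m\times k}$, $Q_2\in\mathbb{R}^{m\times(\min(m,n)-k)}$, $[Q_1\ Q_2]$ has orthonormal columns, $R_{11}\in\mathbb{R}^{k\times k}$ is upper triangular and invertible, $R_{12}\in\mathbb{R}^{k\times(n-k)}$, and $R_{22}\in\mathbb{R}^{(\min(m,n)-k)\times(n-k)}$. Suppose that for some $\mu,\nu\ge1$: 1. $\sigma_k(A)\le\mu\,\sigma_k(R_{11})$, 2. $\|R_{22}\|_2\le\mu\,\sigma_{k+1}(A)$, and 3. $\|R_{11}^{-1}R_{12}\|_{\max}\le\nu$. Then the first $k$ columns of $AP$ form a $\gamma$-local maximum volume $m\times k$ submatrix of $A$ for some $\gamma\le\sqrt{\nu^2+\mu^4}$.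
   Context: $\sigma_1(M)\ge\sigma_2(M)\ge\cdots\ge0$ denote the singular values of a real matrix $M$, $\|M\|_2$ is the spectral norm, and $\|M\|_{\max}$ is the maximum absolute value of its entries. If $k=\min(m,n)$, then $\sigma_{k+1}(A)=0$ and $R_{22}$ is empty; norms of empty matrices are $0$. The volume of $M\in\mathbb{R}^{p\times q}$ is $\mathrm{vol}(M)=\prod_{j=1}^{\min(p,q)}\sigma_j(M)$. A $p\times q$ submatrix of $A$ is specified by a set of $p$ row indices and a set of $q$ column indices. For $\gamma>1$, a $p\times q$ submatrix $B$ of $A$ is a $\gamma$-local maximum volume submatrix (near-local maximum volume with parameter $\gamma$) if $\mathrm{vol}(B)\ge\frac1\gamma\mathrm{vol}(\hat B)$ for all $p\times q$ submatrices $\hat B$ of $A$ that differ from $B$ in at most one row and at most one column. For $m\times k$ submatrices of an $m\times n$ matrix, only replacing a single column is relevant. *)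

theory Defs
  imports
    Complex_Main
    "HOL-Combinatorics.Permutations"
    "Jordan_Normal_Form.Char_Poly"
    "Jordan_Normal_Form.Gauss_Jordan_Elimination"
    "Jordan_Normal_Form.DL_Rank"
    "Jordan_Normal_Form.DL_Submatrix"
begin

text \<open>Rows and columns are numbered from 0, as in the matrix library; singular values are
  numbered from 1.\<close>

text \<open>The eigenvalues of \<open>M\<^sup>T M\<close>, repeated according to multiplicity, are all real and
  nonnegative; their square roots in descending order are the singular values, followed by
  zeros if \<open>M\<close> has more columns than rows.\<close>

definition sing_vals :: "real mat \<Rightarrow> real list" where
  "sing_vals M = map sqrt (rev (sorted_list_of_multiset (proots (char_poly (M\<^sup>T * M)))))"

definition sigma :: "nat \<Rightarrow> real mat \<Rightarrow> real" where
  "sigma j M = (if 1 \<le> j \<and> j \<le> min (dim_row M) (dim_col M) then sing_vals M ! (j - 1) else 0)"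

definition vol :: "real mat \<Rightarrow> real" where
  "vol M = (\<Prod>j = 1..min (dim_row M) (dim_col M). sigma j M)"

text \<open>The operator norm induced by the Euclidean norms. The supremum is over a nonempty set
  bounded above, and it is 0 for a matrix without rows or without columns.\<close>

definition spectral_norm :: "real mat \<Rightarrow> real" where
  "spectral_norm M =
    (SUP v \<in> {v \<in> carrier_vec (dim_col M). sqrt (v \<bullet> v) \<le> 1}. sqrt ((M *\<^sub>v v) \<bullet> (M *\<^sub>v v)))"

definition max_norm :: "real mat \<Rightarrow> real" where
  "max_norm M = (if elements_mat M = {} then 0 else Max (abs ` elements_mat M))"

definition append_cols :: "real mat \<Rightarrow> real mat \<Rightarrow> real mat" (infixr \<open>@\<^sub>c\<close> 65) where
  "A @\<^sub>c B = four_block_mat A B (0\<^sub>m 0 (dim_col A)) (0\<^sub>m 0 (dim_col B))"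

definition orthonormal_cols :: "real mat \<Rightarrow> bool" where
  "orthonormal_cols Q \<longleftrightarrow>
    (\<forall>i < dim_col Q. \<forall>j < dim_col Q. col Q i \<bullet> col Q j = (if i = j then 1 else 0))"

definition perm_mat :: "nat \<Rightarrow> (nat \<Rightarrow> nat) \<Rightarrow> real mat" where
  "perm_mat n \<pi> = mat n n (\<lambda>(i, j). if i = \<pi> j then 1 else 0)"

definition permutation_matrix :: "nat \<Rightarrow> real mat \<Rightarrow> bool" where
  "permutation_matrix n P \<longleftrightarrow> (\<exists>\<pi>. \<pi> permutes {..<n} \<and> P = perm_mat n \<pi>)"

text \<open>For a permutation matrix \<open>P\<close>, the index set of those columns of \<open>A\<close> that become the first
  \<open>k\<close> columns of \<open>A * P\<close>; see the two lemmas below.\<close>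

definition leading_cols :: "nat \<Rightarrow> real mat \<Rightarrow> nat set" where
  "leading_cols k P = {i. i < dim_row P \<and> (\<exists>j < k. P $$ (i, j) = 1)}"

lemma col_mult_perm_mat:
  assumes A: "A \<in> carrier_mat m n" and \<pi>: "\<pi> permutes {..<n}" and j: "j < n"
  shows "col (A * perm_mat n \<pi>) j = col A (\<pi> j)"
proof (rule eq_vecI)
  have \<pi>j: "\<pi> j < n"
    using permutes_in_image[OF \<pi>, of j] j by simp
  show "dim_vec (col (A * perm_mat n \<pi>) j) = dim_vec (col A (\<pi> j))"
    using A by simp
  fix i assume "i < dim_vec (col A (\<pi> j))"
  hence i: "i < m" using A by simp
  have "(A * perm_mat n \<pi>) $$ (i, j) = (\<Sum>l = 0..<n. A $$ (i, l) * (if l = \<pi> j then 1 else 0))"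
    using A i j by (simp add: scalar_prod_def perm_mat_def)
  also have "\<dots> = A $$ (i, \<pi> j)"
    using \<pi>j by (simp add: if_distrib[of "\<lambda>x. _ * x"] cong: if_cong)
  finally show "col (A * perm_mat n \<pi>) j $ i = col A (\<pi> j) $ i"
    using A i j \<pi>j by (simp add: perm_mat_def)
qed

lemma leading_cols_perm_mat:
  assumes \<pi>: "\<pi> permutes {..<n}" and k: "k \<le> n"
  shows "leading_cols k (perm_mat n \<pi>) = \<pi> ` {..<k}"
proof -
  have "\<pi> j < n" if "j < k" for j
    using permutes_in_image[OF \<pi>, of j] that k by simp
  thus ?thesis
    using k by (auto simp: leading_cols_def perm_mat_def split: if_splits)
qed

text \<open>The \<open>p \<times> q\<close> submatrices of \<open>A\<close> are given by their row and column index sets. As the sets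
  \<open>I\<close> and \<open>I'\<close> below have the same size, \<open>card (I' - I) \<le> 1\<close> says that at most one row is
  replaced; likewise for the columns.\<close>

definition submatrix_idx :: "real mat \<Rightarrow> nat \<Rightarrow> nat \<Rightarrow> nat set \<Rightarrow> nat set \<Rightarrow> bool" where
  "submatrix_idx A p q I J \<longleftrightarrow>
    I \<subseteq> {..<dim_row A} \<and> card I = p \<and> J \<subseteq> {..<dim_col A} \<and> card J = q"

definition local_max_vol :: "real \<Rightarrow> real mat \<Rightarrow> nat \<Rightarrow> nat \<Rightarrow> nat set \<Rightarrow> nat set \<Rightarrow> bool" where
  "local_max_vol \<gamma> A p q I J \<longleftrightarrow>
    \<gamma> > 1 \<and> submatrix_idx A p q I J \<and>
    (\<forall>I' J'. submatrix_idx A p q I' J' \<and> card (I' - I) \<le> 1 \<and> card (J' - J) \<le> 1 \<longrightarrow>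
      vol (submatrix A I J) \<ge> 1 / \<gamma> * vol (submatrix A I' J'))"

end

theory Submission
  imports Defs
begin

text \<open>A matrix \<open>M\<close> with at least as many rows as columns has squared volume \<open>det (M\<^sup>T * M)\<close>. Let \<open>C\<close>
  be the first \<open>k\<close> columns of \<open>A * P\<close>, so \<open>C = Q1 * R11\<close>, and let \<open>G = C\<^sup>T * C = R11\<^sup>T * R11\<close>.
  Exchanging column \<open>i\<close> of \<open>C\<close> for another column of \<open>A * P\<close> means replacing it by \<open>C u + d\<close>,
  where \<open>u\<close> is a column of \<open>inverse R11 * R12\<close> and \<open>d\<close> is \<open>Q2\<close> times a column of \<open>R22\<close>, which is
  orthogonal to the columns of \<open>C\<close>. The squared volume of the result is exactly
  \<open>u\<^sub>i\<^sup>2 * det G + (d \<bullet> d) * g\<close>, where \<open>g\<close> is the determinant of \<open>G\<close> without its \<open>i\<close>-th row and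
  column (\<open>gram_det_replace_col\<close>).

  By assumption \<open>\<bar>u\<^sub>i\<bar> \<le> \<nu>\<close>. Next, \<open>\<sigma>\<^sub>k(C)\<^sup>2 * g \<le> det G\<close>, because all eigenvalues of \<open>G\<close> are
  at least \<open>\<sigma>\<^sub>k(C)\<^sup>2\<close> (\<open>rayleigh_lower_bound\<close>, \<open>coercive_cofactor_le_det\<close>). Finally, the
  length of \<open>d\<close> is at most the spectral norm of \<open>R22\<close>, and

    \<open>\<parallel>R22\<parallel> \<le> \<mu> * \<sigma>\<^bsub>k+1\<^esub>(A) \<le> \<mu> * \<sigma>\<^sub>k(A) \<le> \<mu>\<^sup>2 * \<sigma>\<^sub>k(R11) = \<mu>\<^sup>2 * \<sigma>\<^sub>k(C)\<close>.

  Hence the second summand is at most \<open>\<mu> ^ 4 * det G\<close>, and the volume grows by a factor of at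
  most \<open>\<gamma> = sqrt (\<nu>\<^sup>2 + \<mu> ^ 4)\<close>, which exceeds 1.

  The singular values are square roots of the real roots of a characteristic polynomial, so the
  determinant formula for the volume needs this polynomial to split over the reals
  (\<open>gram_char_poly_splits\<close>).\<close>

section \<open>The spectrum of a Gram matrix\<close>

lemma gram_quadratic_form:
  fixes M :: "'a :: comm_ring_1 mat"
  assumes M: "M \<in> carrier_mat m k" and x: "x \<in> carrier_vec k" and y: "y \<in> carrier_vec k"
  shows "x \<bullet> ((M\<^sup>T * M) *\<^sub>v y) = (M *\<^sub>v x) \<bullet> (M *\<^sub>v y)"
proof -
  have My: "M *\<^sub>v y \<in> carrier_vec m" using M y by auto
  have "x \<bullet> ((M\<^sup>T * M) *\<^sub>v y) = x \<bullet> (M\<^sup>T *\<^sub>v (M *\<^sub>v y))"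
    using M y by (subst assoc_mult_mat_vec[of _ k m _ k]) auto
  also have "\<dots> = (M\<^sup>T *\<^sub>v (M *\<^sub>v y)) \<bullet> x"
    using M x My by (intro comm_scalar_prod[of _ k] mult_mat_vec_carrier[of _ k m]) auto
  also have "\<dots> = (M *\<^sub>v y) \<bullet> (M *\<^sub>v x)"
    using transpose_vec_mult_scalar[OF M x My] .
  also have "\<dots> = (M *\<^sub>v x) \<bullet> (M *\<^sub>v y)"
    using M x y by (intro comm_scalar_prod[of _ m]) auto
  finally show ?thesis .
qed

text \<open>For an eigenvector \<open>v\<close> of the complexified Gram matrix,
  \<open>z * (cnj v \<bullet> v) = cnj v \<bullet> (M\<^sup>T * M *\<^sub>v v)\<close>, and the right-hand side is the squared length of
  \<open>M *\<^sub>v v\<close>, because \<open>M\<close> is real and so commutes with conjugation.\<close>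

lemma gram_complex_eigenvalue:
  fixes M :: "real mat"
  assumes M: "M \<in> carrier_mat m k"
    and ev: "eigenvalue (map_mat complex_of_real (M\<^sup>T * M)) z"
  shows "\<exists>b\<ge>0. z = complex_of_real b"
proof -
  let ?N = "map_mat complex_of_real M"
  have N: "?N \<in> carrier_mat m k" using M by auto
  have GN: "map_mat complex_of_real (M\<^sup>T * M) = ?N\<^sup>T * ?N"
    using M by (subst of_real_hom.mat_hom_mult[of _ k m _ k]) (auto simp: map_mat_transpose)
  obtain v where "eigenvector (?N\<^sup>T * ?N) v z"
    using ev unfolding GN eigenvalue_def by auto
  hence v: "v \<in> carrier_vec k" and v0: "v \<noteq> 0\<^sub>v k" and Nv: "(?N\<^sup>T * ?N) *\<^sub>v v = z \<cdot>\<^sub>v v"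
    using M unfolding eigenvector_def by auto
  let ?c = "map_vec cnj v"
  have c: "?c \<in> carrier_vec k" using v by auto
  have Nc: "?N *\<^sub>v ?c = map_vec cnj (?N *\<^sub>v v)"
    using M v by (intro eq_vecI) (auto simp: scalar_prod_def)
  have norm_sum: "map_vec cnj w \<bullet> w = complex_of_real (\<Sum>i<dim_vec w. (cmod (w $ i))\<^sup>2)" for w
    by (auto simp: scalar_prod_def atLeast0LessThan complex_norm_square mult.commute
      simp del: of_real_power intro!: sum.cong)
  let ?s = "\<Sum>i<dim_vec v. (cmod (v $ i))\<^sup>2"
  let ?t = "\<Sum>i<dim_vec (?N *\<^sub>v v). (cmod ((?N *\<^sub>v v) $ i))\<^sup>2"
  \<comment> \<open>a nonzero component makes the squared length of \<open>v\<close> positive, so it can be divided by\<close>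
  obtain i where i: "i < k" "v $ i \<noteq> 0"
    using v v0 by (metis carrier_vecD eq_vecI index_zero_vec)
  have s: "?s > 0"
    using i v by (intro sum_pos2[of _ i]) auto
  have t: "?t \<ge> 0" by (intro sum_nonneg) auto
  have "z * complex_of_real ?s = ?c \<bullet> (z \<cdot>\<^sub>v v)"
    using c v norm_sum[of v] by simp
  also have "\<dots> = (?N *\<^sub>v ?c) \<bullet> (?N *\<^sub>v v)"
    using gram_quadratic_form[OF N c v] Nv by simp
  also have "\<dots> = complex_of_real ?t"
    unfolding Nc by (rule norm_sum)
  finally have "z = complex_of_real (?t / ?s)"
    using s by (simp add: nonzero_eq_divide_eq del: of_real_sum of_real_power)
  thus ?thesis using s t by (intro exI[of _ "?t / ?s"]) auto
qed

text \<open>Over the complex numbers the characteristic polynomial splits, and its roots are real and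
  nonnegative, so the factorization descends to the reals. Without this, the multiset of real
  roots from which the singular values are made could be too small.\<close>

lemma gram_char_poly_splits:
  fixes M :: "real mat"
  assumes M: "M \<in> carrier_mat m k"
  shows "\<exists>bs. char_poly (M\<^sup>T * M) = (\<Prod>b\<leftarrow>bs. [:- b, 1:]) \<and> length bs = k \<and> (\<forall>b\<in>set bs. b \<ge> 0)"
proof -
  interpret of_real_poly_hom: map_poly_inj_idom_hom complex_of_real ..
  let ?G = "M\<^sup>T * M"
  let ?H = "map_mat complex_of_real ?G"
  have G: "?G \<in> carrier_mat k k" and H: "?H \<in> carrier_mat k k" using M by auto
  obtain as where as: "char_poly ?H = (\<Prod>a\<leftarrow>as. [:- a, 1:])" and len: "length as = k"
    using char_poly_factorized[OF H] by auto
  have real: "\<exists>b\<ge>0. a = complex_of_real b" if "a \<in> set as" for a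
  proof -
    have "poly (char_poly ?H) a = 0"
      using that unfolding as by (auto simp: poly_prod_list prod_list_zero_iff)
    hence "eigenvalue ?H a" using eigenvalue_root_char_poly[OF H] by simp
    thus ?thesis by (rule gram_complex_eigenvalue[OF M])
  qed
  let ?bs = "map Re as"
  have as_bs: "as = map complex_of_real ?bs"
    using real by (intro map_idI[symmetric, of as, simplified o_def] nth_equalityI) (auto, metis nth_mem Re_complex_of_real)
  have "map_poly complex_of_real (char_poly ?G) = char_poly ?H"
    by (rule of_real_hom.char_poly_hom[OF G, symmetric])
  also have "\<dots> = map_poly complex_of_real (\<Prod>b\<leftarrow>?bs. [:- b, 1:])"
    unfolding as by (subst as_bs) (simp add: of_real_poly_hom.hom_prod_list o_def)
  finally have "char_poly ?G = (\<Prod>b\<leftarrow>?bs. [:- b, 1:])"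
    by (simp add: of_real_poly_hom.eq_iff)
  moreover have "\<forall>b\<in>set ?bs. b \<ge> 0" using real by force
  ultimately show ?thesis using len by (intro exI[of _ ?bs]) auto
qed

text \<open>Both sides are, up to the same sign, the value of the characteristic polynomial at 0.\<close>

lemma prod_list_roots_eq_det:
  fixes G :: "'a :: comm_ring_1 mat"
  assumes G: "G \<in> carrier_mat k k" and cp: "char_poly G = (\<Prod>b\<leftarrow>bs. [:- b, 1:])" and len: "length bs = k"
  shows "prod_list bs = det G"
proof -
  have "poly (char_poly G) 0 = det ((-1) \<cdot>\<^sub>m G)"
    unfolding char_poly_def using G
    by (intro poly_det_cong[of _ k]) (auto simp: char_poly_matrix_def one_poly_def)
  also have "\<dots> = (-1) ^ k * det G" using G by (simp add: det_smult)
  finally have 1: "poly (char_poly G) 0 = (-1) ^ k * det G" .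
  have "poly (\<Prod>b\<leftarrow>bs. [:- b, 1:]) 0 = (-1) ^ length bs * prod_list bs"
    by (induction bs) auto
  with 1 have "(-1) ^ k * prod_list bs = (-1) ^ k * det G" using len cp by simp
  hence "(-1) ^ k * ((-1) ^ k * prod_list bs) = (-1) ^ k * ((-1) ^ k * det G)" by simp
  thus ?thesis by (simp add: mult.assoc[symmetric] power_mult_distrib[symmetric])
qed

lemma sing_vals_spectrum:
  fixes M :: "real mat"
  assumes M: "M \<in> carrier_mat m k"
  obtains bs where "sing_vals M = map sqrt (rev bs)" "sorted bs" "length bs = k"
    "char_poly (M\<^sup>T * M) = (\<Prod>b\<leftarrow>bs. [:- b, 1:])" "\<forall>b\<in>set bs. b \<ge> 0"
proof -
  obtain cs where cs: "char_poly (M\<^sup>T * M) = (\<Prod>b\<leftarrow>cs. [:- b, 1:])" "length cs = k" "\<forall>b\<in>set cs. b \<ge> 0"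
    using gram_char_poly_splits[OF M] by auto
  define bs where "bs = sort cs"
  have mset: "mset bs = mset cs" unfolding bs_def by simp
  have pl: "prod_list (map f cs) = prod_list (map f bs)" for f :: "real \<Rightarrow> real poly"
    unfolding prod_mset_prod_list[symmetric] mset_map mset ..
  have "proots (\<Prod>b\<leftarrow>cs. [:- b, 1:]) = mset cs"
  proof (induction cs)
    case (Cons c cs)
    have "(\<Prod>b\<leftarrow>cs. [:- b, 1:]) \<noteq> 0" by (auto simp: prod_list_zero_iff)
    thus ?case using Cons by (simp add: proots_mult del: mult_pCons_left)
  qed simp
  hence "sing_vals M = map sqrt (rev bs)"
    unfolding sing_vals_def cs(1) bs_def by (simp add: sorted_list_of_multiset_mset)
  thus ?thesis
    using that[of bs] cs pl unfolding bs_def by auto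
qed

lemma gram_det_nonneg:
  fixes M :: "real mat"
  assumes M: "M \<in> carrier_mat m k"
  shows "det (M\<^sup>T * M) \<ge> 0"
proof -
  obtain bs where bs: "length bs = k" "char_poly (M\<^sup>T * M) = (\<Prod>b\<leftarrow>bs. [:- b, 1:])" "\<forall>b\<in>set bs. b \<ge> 0"
    using sing_vals_spectrum[OF M] by metis
  have "prod_list bs \<ge> 0" using bs(3) by (induction bs) auto
  thus ?thesis using prod_list_roots_eq_det[of "M\<^sup>T * M" k bs] bs M by simp
qed

lemma vol_eq_sqrt_gram_det:
  assumes M: "M \<in> carrier_mat m k" and km: "k \<le> m"
  shows "vol M = sqrt (det (M\<^sup>T * M))"
proof -
  obtain bs where bs: "sing_vals M = map sqrt (rev bs)" "length bs = k"
    "char_poly (M\<^sup>T * M) = (\<Prod>b\<leftarrow>bs. [:- b, 1:])" "\<forall>b\<in>set bs. b \<ge> 0"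
    using sing_vals_spectrum[OF M] by metis
  have "vol M = (\<Prod>j = 1..k. sing_vals M ! (j - 1))"
    unfolding vol_def using M km by (intro prod.cong) (auto simp: sigma_def)
  also have "\<dots> = (\<Prod>j = 0..<k. sing_vals M ! j)"
    by (rule prod.reindex_bij_witness[of _ Suc "\<lambda>j. j - 1"]) auto
  also have "\<dots> = prod_list (sing_vals M)"
    using bs by (simp add: prod.list_conv_set_nth)
  also have "\<dots> = sqrt (prod_list bs)"
    unfolding bs(1) by (simp add: rev_map[symmetric] prod_list.rev) (induction bs, auto simp: real_sqrt_mult)
  also have "prod_list bs = det (M\<^sup>T * M)"
    using M bs by (intro prod_list_roots_eq_det[of _ k]) auto
  finally show ?thesis .
qed

lemma sigma_Suc_le:
  assumes k: "1 \<le> k" "k \<le> min (dim_row M) (dim_col M)"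
  shows "sigma (Suc k) M \<le> sigma k M"
proof -
  obtain bs where bs: "sing_vals M = map sqrt (rev bs)" "sorted bs" "length bs = dim_col M" "\<forall>b\<in>set bs. b \<ge> 0"
    using sing_vals_spectrum[of M "dim_row M" "dim_col M"] by blast
  have nth: "sing_vals M ! i = sqrt (bs ! (dim_col M - Suc i))" if "i < dim_col M" for i
    using that bs by (simp add: rev_nth)
  show ?thesis
  proof (cases "Suc k \<le> min (dim_row M) (dim_col M)")
    case True
    have "bs ! (dim_col M - Suc k) \<le> bs ! (dim_col M - k)"
      using True k bs by (intro sorted_nth_mono) auto
    thus ?thesis using True k by (auto simp: sigma_def nth)
  next
    case False
    have "bs ! (dim_col M - k) \<ge> 0" using k bs by auto
    thus ?thesis using False k nth[of "k - 1"] by (auto simp: sigma_def)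
  qed
qed

text \<open>The \<open>k\<close>-th of the \<open>k\<close> singular values comes from the first entry of the ascending list of
  eigenvalues. The condition \<open>k \<le> m\<close> matters: for a wide matrix, \<open>sigma\<close> is 0 by convention
  beyond the number of rows.\<close>

lemma sigma_last_eigenvalue_bound:
  assumes M: "M \<in> carrier_mat m k" and k: "1 \<le> k" "k \<le> m"
    and b: "eigenvalue (M\<^sup>T * M) b"
  shows "(sigma k M)\<^sup>2 \<le> b"
proof -
  obtain bs where bs: "sing_vals M = map sqrt (rev bs)" "sorted bs" "length bs = k"
    "char_poly (M\<^sup>T * M) = (\<Prod>b\<leftarrow>bs. [:- b, 1:])" "\<forall>b\<in>set bs. b \<ge> 0"
    using sing_vals_spectrum[OF M] by metis
  have s: "sigma k M = sqrt (bs ! 0)" and nn: "bs ! 0 \<ge> 0"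
    using M k bs by (auto simp: sigma_def rev_nth)
  have "poly (char_poly (M\<^sup>T * M)) b = 0"
    using b eigenvalue_root_char_poly[of "M\<^sup>T * M" k] M by simp
  hence "b \<in> set bs" unfolding bs by (auto simp: poly_prod_list prod_list_zero_iff)
  then obtain i where "i < k" "b = bs ! i" using bs by (auto simp: in_set_conv_nth)
  thus "(sigma k M)\<^sup>2 \<le> b" using s nn bs by (simp add: sorted_nth_mono)
qed

section \<open>Rayleigh bound for symmetric matrices\<close>

lemma scalar_prod_self_sum: "(x::real vec) \<bullet> x = (\<Sum>i<dim_vec x. (x $ i)\<^sup>2)"
  by (simp add: scalar_prod_def atLeast0LessThan power2_eq_square)

lemma scalar_prod_self_nonneg: "(x::real vec) \<bullet> x \<ge> 0"
  unfolding scalar_prod_self_sum by (intro sum_nonneg) auto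

lemma scalar_prod_self_ge: "i < dim_vec x \<Longrightarrow> (x $ i)\<^sup>2 \<le> (x::real vec) \<bullet> x"
  unfolding scalar_prod_self_sum by (rule member_le_sum) auto

lemma quadratic_form_bounded:
  fixes K :: "real mat"
  assumes K: "K \<in> carrier_mat k k"
  obtains C where "C > 0" "\<And>x. x \<in> carrier_vec k \<Longrightarrow> \<bar>x \<bullet> (K *\<^sub>v x)\<bar> \<le> C * (x \<bullet> x)"
proof
  let ?C = "\<Sum>i<k. \<Sum>j<k. \<bar>K $$ (i, j)\<bar>"
  show "?C + 1 > 0" by (intro add_nonneg_pos sum_nonneg) auto
  fix x :: "real vec" assume x: "x \<in> carrier_vec k"
  have "x \<bullet> (K *\<^sub>v x) = (\<Sum>i<k. \<Sum>j<k. K $$ (i, j) * (x $ i * x $ j))"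
    using K x by (simp add: scalar_prod_def atLeast0LessThan sum_distrib_left mult_ac)
  also have "\<bar>\<dots>\<bar> \<le> (\<Sum>i<k. \<Sum>j<k. \<bar>K $$ (i, j) * (x $ i * x $ j)\<bar>)"
    by (rule order_trans[OF sum_abs sum_mono[OF sum_abs]])
  also have "\<dots> \<le> (\<Sum>i<k. \<Sum>j<k. \<bar>K $$ (i, j)\<bar> * (x \<bullet> x))"
  proof (intro sum_mono)
    fix i j assume "i \<in> {..<k}" "j \<in> {..<k}"
    hence "(x $ i)\<^sup>2 \<le> x \<bullet> x" "(x $ j)\<^sup>2 \<le> x \<bullet> x"
      using x by (auto intro: scalar_prod_self_ge)
    moreover have "\<bar>x $ i * x $ j\<bar> \<le> ((x $ i)\<^sup>2 + (x $ j)\<^sup>2) / 2"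
      using sum_squares_bound[of "\<bar>x $ i\<bar>" "\<bar>x $ j\<bar>"] by (simp add: abs_mult)
    ultimately have "\<bar>x $ i * x $ j\<bar> \<le> x \<bullet> x" by simp
    thus "\<bar>K $$ (i, j) * (x $ i * x $ j)\<bar> \<le> \<bar>K $$ (i, j)\<bar> * (x \<bullet> x)"
      by (simp add: abs_mult[of "K $$ (i, j)"] mult_left_mono)
  qed
  also have "\<dots> = ?C * (x \<bullet> x)" by (simp add: sum_distrib_right)
  also have "\<dots> \<le> (?C + 1) * (x \<bullet> x)"
    using scalar_prod_self_nonneg[of x] by (simp add: distrib_right)
  finally show "\<bar>x \<bullet> (K *\<^sub>v x)\<bar> \<le> (?C + 1) * (x \<bullet> x)" .
qed

lemma symmetric_form_swap:
  fixes H :: "real mat"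
  assumes H: "H \<in> carrier_mat k k" "H\<^sup>T = H" and x: "x \<in> carrier_vec k" and y: "y \<in> carrier_vec k"
  shows "y \<bullet> (H *\<^sub>v x) = x \<bullet> (H *\<^sub>v y)"
proof -
  have "x \<bullet> (H *\<^sub>v y) = (H\<^sup>T *\<^sub>v x) \<bullet> y"
    using transpose_vec_mult_scalar[of H k k y x] assms by simp
  also have "\<dots> = y \<bullet> (H *\<^sub>v x)"
    using assms by (subst comm_scalar_prod[of _ k]) auto
  finally show ?thesis ..
qed

text \<open>Let \<open>K\<close> be the inverse of \<open>H\<close> and let \<open>C\<close> bound its quadratic form. Expanding the
  nonnegative value of the form of \<open>H\<close> at \<open>x - s K x\<close> gives
  \<open>x \<bullet> H x \<ge> (2 s - s\<^sup>2 C) (x \<bullet> x)\<close>, and \<open>s = 1 / C\<close> makes the factor on the right equal to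
  \<open>1 / C\<close>.\<close>

lemma psd_invertible_coercive:
  fixes H :: "real mat"
  assumes H: "H \<in> carrier_mat k k" "H\<^sup>T = H" and det: "det H \<noteq> 0"
    and psd: "\<And>x. x \<in> carrier_vec k \<Longrightarrow> 0 \<le> x \<bullet> (H *\<^sub>v x)"
  obtains \<epsilon> where "\<epsilon> > 0" "\<And>x. x \<in> carrier_vec k \<Longrightarrow> \<epsilon> * (x \<bullet> x) \<le> x \<bullet> (H *\<^sub>v x)"
proof -
  define K where "K = (1 / det H) \<cdot>\<^sub>m adj_mat H"
  have K: "K \<in> carrier_mat k k" using adj_mat(1)[OF H(1)] unfolding K_def by auto
  have HK: "H * K = 1\<^sub>m k"
    using adj_mat(1,2)[OF H(1)] H det unfolding K_def
    by (subst mult_smult_distrib[of _ k k]) auto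
  obtain C where C: "C > 0" "\<And>x. x \<in> carrier_vec k \<Longrightarrow> \<bar>x \<bullet> (K *\<^sub>v x)\<bar> \<le> C * (x \<bullet> x)"
    using quadratic_form_bounded[OF K] by blast
  show ?thesis
  proof
    show "1 / C > 0" using C by simp
    fix x :: "real vec" assume x: "x \<in> carrier_vec k"
    define y where "y = K *\<^sub>v x"
    define s where "s = 1 / C"
    have y: "y \<in> carrier_vec k" using K x unfolding y_def by simp
    have Hy: "H *\<^sub>v y = x"
      unfolding y_def using x H K HK by (subst assoc_mult_mat_vec[symmetric, of _ k k _ k]) auto
    have Hx: "H *\<^sub>v x \<in> carrier_vec k" using H x by auto
    have "H *\<^sub>v (x - s \<cdot>\<^sub>v y) = H *\<^sub>v x - s \<cdot>\<^sub>v x"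
      using H x y Hy by (simp add: mult_minus_distrib_mat_vec[of _ k k] mult_mat_vec[of _ k k])
    hence "(x - s \<cdot>\<^sub>v y) \<bullet> (H *\<^sub>v (x - s \<cdot>\<^sub>v y)) =
        x \<bullet> (H *\<^sub>v x) - s * (x \<bullet> x) - s * (y \<bullet> (H *\<^sub>v x)) + s * s * (y \<bullet> x)"
      using x y Hx by (simp add: minus_scalar_prod_distrib[of _ k] scalar_prod_minus_distrib[of _ k] algebra_simps)
    also have "y \<bullet> (H *\<^sub>v x) = x \<bullet> x"
      using symmetric_form_swap[OF H x y] Hy by simp
    also have "y \<bullet> x = x \<bullet> (K *\<^sub>v x)"
      using x y unfolding y_def by (subst comm_scalar_prod[of _ k]) auto
    finally have "0 \<le> x \<bullet> (H *\<^sub>v x) - 2 * s * (x \<bullet> x) + s * s * (x \<bullet> (K *\<^sub>v x))"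
      using psd[of "x - s \<cdot>\<^sub>v y"] x y by simp
    moreover have "s * s * (x \<bullet> (K *\<^sub>v x)) \<le> s * s * (C * (x \<bullet> x))"
      using C(2)[OF x] by (intro mult_left_mono) auto
    moreover have "s * s * (C * (x \<bullet> x)) = s * (x \<bullet> x)"
      unfolding s_def using C by simp
    ultimately show "1 / C * (x \<bullet> x) \<le> x \<bullet> (H *\<^sub>v x)"
      unfolding s_def by simp
  qed
qed

text \<open>For \<open>k > 0\<close>, let \<open>t0\<close> be the largest \<open>t\<close> for which \<open>G - t I\<close> is positive semidefinite. Then \<open>t0\<close> is an
  eigenvalue of \<open>G\<close>: otherwise \<open>G - t0 I\<close> would be invertible, hence bounded below by some
  \<open>\<epsilon> I\<close>, and \<open>t0 + \<epsilon>\<close> would also qualify. So every lower bound for the eigenvalues is at most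
  \<open>t0\<close>. This replaces diagonalization of \<open>G\<close>.\<close>

lemma rayleigh_lower_bound:
  fixes G :: "real mat"
  assumes G: "G \<in> carrier_mat k k" "G\<^sup>T = G"
    and ev: "\<And>t. eigenvalue G t \<Longrightarrow> l \<le> t"
    and x: "x \<in> carrier_vec k"
  shows "l * (x \<bullet> x) \<le> x \<bullet> (G *\<^sub>v x)"
proof (cases "k = 0")
  case True
  thus ?thesis using x G by (simp add: scalar_prod_def)
next
  case False
  define S where "S = {t. \<forall>x \<in> carrier_vec k. t * (x \<bullet> x) \<le> x \<bullet> (G *\<^sub>v x)}"
  obtain C where C: "C > 0" "\<And>x. x \<in> carrier_vec k \<Longrightarrow> \<bar>x \<bullet> (G *\<^sub>v x)\<bar> \<le> C * (x \<bullet> x)"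
    using quadratic_form_bounded[OF G(1)] by blast
  \<comment> \<open>a two-sided bound on the form makes \<open>S\<close> nonempty\<close>
  have "- C \<in> S" unfolding S_def using C(2) by (force simp: abs_le_iff)
  hence ne: "S \<noteq> {}" by auto
  let ?e = "unit_vec k 0 :: real vec"
  have ee: "?e \<bullet> ?e = 1" using False by simp
  have bdd: "bdd_above S"
  proof (rule bdd_aboveI)
    fix t assume "t \<in> S"
    thus "t \<le> ?e \<bullet> (G *\<^sub>v ?e)" using ee unfolding S_def by (metis (mono_tags, lifting) mem_Collect_eq mult.right_neutral unit_vec_carrier)
  qed
  define t0 where "t0 = Sup S"
  have t0: "t0 * (y \<bullet> y) \<le> y \<bullet> (G *\<^sub>v y)" if y: "y \<in> carrier_vec k" for y
  proof (cases "y \<bullet> y = 0")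
    case True
    thus ?thesis using C(2)[OF y] by simp
  next
    case False
    hence pos: "y \<bullet> y > 0" using scalar_prod_self_nonneg[of y] by simp
    have "t0 \<le> (y \<bullet> (G *\<^sub>v y)) / (y \<bullet> y)"
      unfolding t0_def using y pos by (intro cSup_least[OF ne]) (auto simp: S_def pos_le_divide_eq)
    thus ?thesis using pos by (simp add: pos_le_divide_eq)
  qed
  have "eigenvalue G t0"
  proof (rule ccontr)
    assume nev: "\<not> eigenvalue G t0"
    define H where "H = G - t0 \<cdot>\<^sub>m 1\<^sub>m k"
    have H: "H \<in> carrier_mat k k" unfolding H_def by auto
    have HT: "H\<^sup>T = H"
    proof (rule eq_matI)
      fix i j assume ij: "i < dim_row H" "j < dim_col H"
      have "G $$ (j, i) = G $$ (i, j)" using G ij H by (metis carrier_matD index_transpose_mat(1))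
      thus "H\<^sup>T $$ (i, j) = H $$ (i, j)" using ij G H unfolding H_def by auto
    qed (use H in auto)
    have Hx: "y \<bullet> (H *\<^sub>v y) = y \<bullet> (G *\<^sub>v y) - t0 * (y \<bullet> y)" if y: "y \<in> carrier_vec k" for y
    proof -
      have "H *\<^sub>v y = G *\<^sub>v y - t0 \<cdot>\<^sub>v y"
        unfolding H_def using y G by (subst minus_mult_distrib_mat_vec[of _ k k]) auto
      thus ?thesis using y G by (simp add: scalar_prod_minus_distrib[of _ k])
    qed
    have det: "det H \<noteq> 0"
    proof
      assume "det H = 0"
      then obtain v where v: "v \<in> carrier_vec k" "v \<noteq> 0\<^sub>v k" "H *\<^sub>v v = 0\<^sub>v k"
        using det_0_iff_vec_prod_zero_field[OF H] by auto
      have "H *\<^sub>v v = G *\<^sub>v v - t0 \<cdot>\<^sub>v v"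
        using v G unfolding H_def by (subst minus_mult_distrib_mat_vec[of _ k k]) auto
      hence "G *\<^sub>v v - t0 \<cdot>\<^sub>v v = 0\<^sub>v k" using v by simp
      hence "G *\<^sub>v v = t0 \<cdot>\<^sub>v v"
        using v G by (intro eq_vecI) (auto dest!: vec_eq_iff[THEN iffD1])
      thus False using nev v G unfolding eigenvalue_def eigenvector_def by auto
    qed
    obtain \<epsilon> where e: "\<epsilon> > 0" "\<And>x. x \<in> carrier_vec k \<Longrightarrow> \<epsilon> * (x \<bullet> x) \<le> x \<bullet> (H *\<^sub>v x)"
      using psd_invertible_coercive[OF H HT det] t0 Hx by (metis diff_ge_0_iff_ge)
    have "t0 + \<epsilon> \<in> S"
      unfolding S_def using e(2) Hx by (force simp: distrib_right)
    hence "t0 + \<epsilon> \<le> t0" unfolding t0_def using bdd by (rule cSup_upper)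
    thus False using e by simp
  qed
  hence "l * (x \<bullet> x) \<le> t0 * (x \<bullet> x)"
    using ev by (intro mult_right_mono scalar_prod_self_nonneg) auto
  thus ?thesis using t0[OF x] by simp
qed

text \<open>If \<open>l\<close> and \<open>det G\<close> are positive, this says that a diagonal entry of the inverse of \<open>G\<close> is
  at most \<open>1 / l\<close>. The proof evaluates the quadratic form at the \<open>i\<close>-th column \<open>y\<close> of the adjugate, for which
  \<open>G y = det G e\<^sub>i\<close> and \<open>y\<^sub>i\<close> is the minor in question.\<close>

lemma coercive_cofactor_le_det:
  fixes G :: "real mat"
  assumes G: "G \<in> carrier_mat k k" and i: "i < k" and l: "0 \<le> l" and det: "0 \<le> det G"
    and coercive: "\<And>x. x \<in> carrier_vec k \<Longrightarrow> l * (x \<bullet> x) \<le> x \<bullet> (G *\<^sub>v x)"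
  shows "l * det (mat_delete G i i) \<le> det G"
proof (cases "det (mat_delete G i i) \<le> 0")
  case True
  thus ?thesis using l det by (meson mult_nonneg_nonpos order_trans)
next
  case False
  define y where "y = col (adj_mat G) i"
  note adj = adj_mat(1,2)[OF G]
  have y: "y \<in> carrier_vec k" using adj i unfolding y_def by auto
  have yi: "y $ i = det (mat_delete G i i)"
    using G i unfolding y_def adj_mat_def cofactor_def by (simp flip: mult_2)
  have "G *\<^sub>v y = col (G * adj_mat G) i"
    using G adj i unfolding y_def by (subst col_mult2[of _ k k _ k]) auto
  also have "\<dots> = det G \<cdot>\<^sub>v unit_vec k i"
    unfolding adj(2) using i by (intro eq_vecI) auto
  finally have "y \<bullet> (G *\<^sub>v y) = det G * y $ i"
    using y i by simp
  hence "l * (y $ i)\<^sup>2 \<le> det G * y $ i"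
    using coercive[OF y] mult_left_mono[OF scalar_prod_self_ge[of i y] l] y i by simp
  thus ?thesis using False unfolding yi by (simp add: power2_eq_square)
qed

section \<open>Columns, entries and matrix norms\<close>

text \<open>A column is the image of a unit vector. Most of the proof goes into showing that the
  supremum in the definition of the norm is over a set bounded above.\<close>

lemma column_norm_le_spectral_norm:
  assumes M: "M \<in> carrier_mat p q" and j: "j < q"
  shows "sqrt (col M j \<bullet> col M j) \<le> spectral_norm M"
proof -
  let ?V = "{v \<in> carrier_vec (dim_col M). sqrt (v \<bullet> v) \<le> 1}"
  let ?f = "\<lambda>v. sqrt ((M *\<^sub>v v) \<bullet> (M *\<^sub>v v))"
  have G: "M\<^sup>T * M \<in> carrier_mat q q" using M by auto
  obtain C where C: "C > 0" "\<And>x. x \<in> carrier_vec q \<Longrightarrow> \<bar>x \<bullet> ((M\<^sup>T * M) *\<^sub>v x)\<bar> \<le> C * (x \<bullet> x)"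
    using quadratic_form_bounded[OF G] by blast
  have bdd: "bdd_above (?f ` ?V)"
  proof (rule bdd_aboveI2)
    fix v assume "v \<in> ?V"
    hence v: "v \<in> carrier_vec q" "v \<bullet> v \<le> 1" using M by auto
    have "(M *\<^sub>v v) \<bullet> (M *\<^sub>v v) = v \<bullet> ((M\<^sup>T * M) *\<^sub>v v)" using gram_quadratic_form[OF M v(1) v(1)] by simp
    also have "\<dots> \<le> C * (v \<bullet> v)" using C(2)[OF v(1)] by simp
    also have "\<dots> \<le> C" using v C by (simp add: mult_left_le)
    finally show "?f v \<le> sqrt C" by simp
  qed
  have "M *\<^sub>v unit_vec q j = col M j"
    using M j by (intro eq_vecI) auto
  hence "sqrt (col M j \<bullet> col M j) = ?f (unit_vec q j)" by simp
  also have "\<dots> \<le> spectral_norm M"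
    unfolding spectral_norm_def using M j by (intro cSUP_upper[OF _ bdd]) auto
  finally show ?thesis .
qed

lemma abs_entry_le_max_norm:
  assumes "i < dim_row M" "j < dim_col M"
  shows "\<bar>M $$ (i, j)\<bar> \<le> max_norm M"
proof -
  have "M $$ (i, j) \<in> elements_mat M" using assms by (intro elements_matI[of M]) auto
  moreover have "finite (elements_mat M)" unfolding elements_mat_def by simp
  ultimately show ?thesis unfolding max_norm_def by auto
qed

section \<open>Replacing one column of a matrix\<close>

lemma det_add_diagonal_entry:
  fixes X :: "'a :: comm_ring_1 mat"
  assumes X: "X \<in> carrier_mat k k" and i: "i < k"
  shows "det (mat k k (\<lambda>(a, b). X $$ (a, b) + (if a = i \<and> b = i then c else 0)))
    = det X + c * det (mat_delete X i i)"
proof -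
  let ?Y = "mat k k (\<lambda>(a, b). X $$ (a, b) + (if a = i \<and> b = i then c else 0))"
  have Y: "?Y \<in> carrier_mat k k" by auto
  have minor: "mat_delete ?Y a i = mat_delete X a i" if "a < k" for a
    using X i by (intro eq_matI) (auto simp: mat_delete_def)
  have cof: "cofactor ?Y a i = cofactor X a i" if "a < k" for a
    using minor[OF that] by (simp add: cofactor_def)
  have "det ?Y = (\<Sum>a<k. ?Y $$ (a, i) * cofactor ?Y a i)"
    by (rule laplace_expansion_column[OF Y i])
  also have "\<dots> = (\<Sum>a<k. X $$ (a, i) * cofactor X a i + (if a = i then c * cofactor X i i else 0))"
    using i by (intro sum.cong) (auto simp: cof distrib_right)
  also have "\<dots> = det X + c * cofactor X i i"
    using i by (simp add: sum.distrib laplace_expansion_column[OF X i])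
  also have "cofactor X i i = det (mat_delete X i i)"
    by (simp add: cofactor_def flip: mult_2)
  finally show ?thesis .
qed

lemma col_replace_col:
  assumes "C \<in> carrier_mat m k" "b < k" "c \<in> carrier_vec m"
  shows "col (replace_col C c i) b = (if b = i then c else col C b)"
  using assms by (intro eq_vecI) (auto simp: replace_col_def)

text \<open>This is the exact change of the squared volume when column \<open>i\<close> of \<open>C\<close> is replaced by
  \<open>C u + d\<close> with \<open>d\<close> orthogonal to the columns of \<open>C\<close>. The part \<open>C u\<close> amounts to multiplying \<open>C\<close>
  by the identity matrix with column \<open>i\<close> replaced by \<open>u\<close>, whose determinant is \<open>u\<^sub>i\<close>. By
  orthogonality the part \<open>d\<close> changes only the entry \<open>(i, i)\<close> of the Gram matrix, and the minor
  belonging to that entry does not see column \<open>i\<close> at all.\<close>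

lemma gram_det_replace_col:
  fixes C :: "'a :: field mat"
  assumes C: "C \<in> carrier_mat m k" and u: "u \<in> carrier_vec k" and d: "d \<in> carrier_vec m"
    and i: "i < k" and orth: "C\<^sup>T *\<^sub>v d = 0\<^sub>v k"
  defines "D \<equiv> replace_col C (C *\<^sub>v u + d) i"
  shows "det (D\<^sup>T * D) = (u $ i)\<^sup>2 * det (C\<^sup>T * C) + (d \<bullet> d) * det (mat_delete (C\<^sup>T * C) i i)"
proof -
  define T where "T = replace_col (1\<^sub>m k) u i"
  define B where "B = C * T"
  have T: "T \<in> carrier_mat k k" unfolding T_def replace_col_def by auto
  have B: "B \<in> carrier_mat m k" unfolding B_def using C T by auto
  have D: "D \<in> carrier_mat m k" unfolding D_def replace_col_def using C by auto
  have detT: "det T = u $ i"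
    using cramer_lemma_mat[OF one_carrier_mat u i] u unfolding T_def by simp
  have colT: "col T b = (if b = i then u else unit_vec k b)" if "b < k" for b
    unfolding T_def using that u by (subst col_replace_col[of _ k k]) auto
  have colB: "col B b = (if b = i then C *\<^sub>v u else col C b)" if "b < k" for b
  proof -
    have "col B b = C *\<^sub>v col T b" unfolding B_def using that C T by (intro col_mult2) auto
    also have "\<dots> = (if b = i then C *\<^sub>v u else col C b)"
      using that C unfolding colT[OF that] by (auto intro!: eq_vecI)
    finally show ?thesis .
  qed
  have colD: "col D b = col B b + (if b = i then d else 0\<^sub>v m)" if "b < k" for b
    unfolding D_def colB[OF that] using that C u d by (subst col_replace_col[of _ m k]) auto
  have d_colB: "col B b \<bullet> d = 0" if "b < k" for b
  proof -
    have "col B b = C *\<^sub>v col T b" unfolding B_def using that C T by (intro col_mult2) auto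
    hence "col B b \<bullet> d = d \<bullet> (C *\<^sub>v col T b)"
      using C T d that by (subst comm_scalar_prod[of _ m]) auto
    also have "\<dots> = (C\<^sup>T *\<^sub>v d) \<bullet> col T b"
      using C T d that by (intro transpose_vec_mult_scalar[symmetric, of _ m k]) auto
    finally show ?thesis using orth T that by auto
  qed
  have "D\<^sup>T * D = mat k k (\<lambda>(a, b). (B\<^sup>T * B) $$ (a, b) + (if a = i \<and> b = i then d \<bullet> d else 0))"
  proof (rule eq_matI, goal_cases)
    case (1 a b)
    hence ab: "a < k" "b < k" by auto
    have d_colB': "d \<bullet> col B a = 0"
      using d_colB[OF ab(1)] B d by (subst comm_scalar_prod[of _ m]) auto
    have "(D\<^sup>T * D) $$ (a, b) = col D a \<bullet> col D b" using ab D by simp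
    also have "\<dots> = col B a \<bullet> col B b + (if a = i \<and> b = i then d \<bullet> d else 0)"
      using ab B d d_colB d_colB' d_colB[OF ab(2)] comm_scalar_prod[of d m "col B b"]
      by (auto simp: colD scalar_prod_add_distrib[of _ m] add_scalar_prod_distrib[of _ m])
    finally show ?case using ab B by simp
  qed (use D in auto)
  hence "det (D\<^sup>T * D) = det (B\<^sup>T * B) + (d \<bullet> d) * det (mat_delete (B\<^sup>T * B) i i)"
    using det_add_diagonal_entry[of "B\<^sup>T * B" k i "d \<bullet> d"] B i by simp
  also have "B\<^sup>T * B = T\<^sup>T * (C\<^sup>T * C * T)"
    unfolding B_def using C T
    by (simp add: transpose_mult[of _ m k] assoc_mult_mat[of _ k k _ m _ k] assoc_mult_mat[of _ k m _ k _ k])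
  also have "det \<dots> = det T * (det (C\<^sup>T * C) * det T)"
    using C T by (subst det_mult[of _ k]; (subst det_mult[of _ k])?) (auto simp: det_transpose)
  also have "mat_delete (T\<^sup>T * (C\<^sup>T * C * T)) i i = mat_delete (B\<^sup>T * B) i i"
    unfolding \<open>B\<^sup>T * B = T\<^sup>T * (C\<^sup>T * C * T)\<close> ..
  also have "\<dots> = mat_delete (C\<^sup>T * C) i i"
    using B C i by (intro eq_matI) (auto simp: mat_delete_def colB)
  finally show ?thesis by (simp add: detT power2_eq_square algebra_simps)
qed

text \<open>The minor in the exact formula is at most \<open>det (C\<^sup>T * C) / \<sigma>\<^sub>k(C)\<^sup>2\<close>, which cancels the
  \<open>\<sigma>\<^sub>k(C)\<^sup>2\<close> in the bound for \<open>d \<bullet> d\<close>. Writing both bounds without quotients covers the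
  case \<open>\<sigma>\<^sub>k(C) = 0\<close>.\<close>

lemma gram_det_replace_col_le:
  assumes C: "C \<in> carrier_mat m k" and km: "k \<le> m" and i: "i < k"
    and u: "u \<in> carrier_vec k" and d: "d \<in> carrier_vec m" and orth: "C\<^sup>T *\<^sub>v d = 0\<^sub>v k"
    and ui: "\<bar>u $ i\<bar> \<le> \<nu>" and dd: "sqrt (d \<bullet> d) \<le> \<rho> * sigma k C"
  defines "D \<equiv> replace_col C (C *\<^sub>v u + d) i"
  shows "det (D\<^sup>T * D) \<le> (\<nu>\<^sup>2 + \<rho>\<^sup>2) * det (C\<^sup>T * C)"
proof -
  let ?G = "C\<^sup>T * C" and ?s = "sigma k C"
  let ?c = "det (mat_delete ?G i i)"
  have G: "?G \<in> carrier_mat k k" "?G\<^sup>T = ?G" using C by (auto simp: transpose_mult[of _ k m _ k])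
  have k1: "1 \<le> k" using i by simp
  have det0: "det ?G \<ge> 0" by (rule gram_det_nonneg[OF C])
  have minor: "?s\<^sup>2 * ?c \<le> det ?G"
    by (intro coercive_cofactor_le_det[OF G(1) i _ det0] rayleigh_lower_bound[OF G]
        sigma_last_eigenvalue_bound[OF C k1 km]) auto
  have "(sqrt (d \<bullet> d))\<^sup>2 \<le> (\<rho> * ?s)\<^sup>2" using dd by (intro power_mono) (auto simp: scalar_prod_self_nonneg)
  hence dd2: "d \<bullet> d \<le> \<rho>\<^sup>2 * ?s\<^sup>2" by (simp add: scalar_prod_self_nonneg power_mult_distrib)
  have "(d \<bullet> d) * ?c \<le> \<rho>\<^sup>2 * det ?G"
  proof (cases "?c \<ge> 0")
    case True
    hence "(d \<bullet> d) * ?c \<le> \<rho>\<^sup>2 * (?s\<^sup>2 * ?c)" using dd2 mult_right_mono by fastforce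
    also have "\<dots> \<le> \<rho>\<^sup>2 * det ?G" using minor by (intro mult_left_mono) auto
    finally show ?thesis .
  next
    case False
    hence "(d \<bullet> d) * ?c \<le> 0" using scalar_prod_self_nonneg[of d] by (simp add: mult_nonneg_nonpos)
    thus ?thesis using det0 by (meson order_trans mult_nonneg_nonneg zero_le_power2)
  qed
  moreover have "(u $ i)\<^sup>2 * det ?G \<le> \<nu>\<^sup>2 * det ?G"
    using ui det0 by (intro mult_right_mono) (auto simp: abs_le_square_iff[symmetric])
  ultimately show ?thesis
    unfolding D_def gram_det_replace_col[OF C u d i orth] by (simp add: distrib_right)
qed

section \<open>Volume of a column selection\<close>

text \<open>Columns may be selected in any order, whereas \<open>submatrix\<close> always lists them in increasing
  order of their indices.\<close>

definition select_cols :: "'a mat \<Rightarrow> nat \<Rightarrow> (nat \<Rightarrow> nat) \<Rightarrow> 'a mat" where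
  "select_cols A k f = mat (dim_row A) k (\<lambda>(i, j). A $$ (i, f j))"

lemma select_cols_carrier [simp]: "A \<in> carrier_mat m n \<Longrightarrow> select_cols A k f \<in> carrier_mat m k"
  by (simp add: select_cols_def)

text \<open>Permuting the columns permutes the rows and the columns of the Gram matrix by the same
  permutation, so the two signs cancel.\<close>

lemma gram_det_permute_cols:
  fixes A :: "'a :: comm_ring_1 mat"
  assumes A: "A \<in> carrier_mat m n" and p: "p permutes {0..<k}"
  shows "det ((select_cols A k (f \<circ> p))\<^sup>T * select_cols A k (f \<circ> p))
    = det ((select_cols A k f)\<^sup>T * select_cols A k f)"
proof -
  let ?M = "select_cols A k f" and ?N = "select_cols A k (f \<circ> p)"
  let ?G = "?M\<^sup>T * ?M"
  have G: "?G \<in> carrier_mat k k" using A by (auto simp: select_cols_def)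
  have pk: "p a < k" if "a < k" for a using permutes_in_image[OF p, of a] that by simp
  define H where "H = mat k k (\<lambda>(a, b). ?G $$ (p a, b))"
  have H: "H \<in> carrier_mat k k" unfolding H_def by auto
  have "?N\<^sup>T * ?N = (mat k k (\<lambda>(a, b). H\<^sup>T $$ (p a, b)))\<^sup>T"
    using A by (intro eq_matI) (auto simp: H_def pk select_cols_def scalar_prod_def)
  hence "det (?N\<^sup>T * ?N) = det (mat k k (\<lambda>(a, b). H\<^sup>T $$ (p a, b)))"
    by (simp add: det_transpose[of _ k])
  also have "\<dots> = signof p * det H"
    using H det_permute_rows[of "H\<^sup>T" k p] p by (simp add: det_transpose[of _ k])
  also have "det H = signof p * det ?G"
    unfolding H_def by (rule det_permute_rows[OF G p])
  also have "signof p * (signof p * det ?G) = det ?G"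
    by (cases p rule: sign_cases) auto
  finally show ?thesis .
qed

lemma vol_submatrix_eq_gram_det:
  assumes A: "A \<in> carrier_mat m n" and km: "k \<le> m" and J: "J \<subseteq> {..<n}" and f: "bij_betw f {..<k} J"
  shows "vol (submatrix A {..<m} J) = sqrt (det ((select_cols A k f)\<^sup>T * select_cols A k f))"
proof -
  have cJ: "card J = k" and finJ: "finite J" using f J bij_betw_same_card finite_subset by fastforce+
  \<comment> \<open>\<open>p x\<close> is the position of \<open>f x\<close> in the increasing enumeration of \<open>J\<close>\<close>
  define p where "p x = (if x < k then card {a \<in> J. a < f x} else x)" for x
  have fJ: "f x \<in> J" if "x < k" for x using f that by (auto simp: bij_betw_def)
  have pick_p: "pick J (p x) = f x" if "x < k" for x
    using that fJ by (simp add: p_def pick_card_in_set)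
  have "p x < k" if "x < k" for x
  proof -
    have "{a \<in> J. a < f x} \<subset> J" using fJ[OF that] by auto
    thus ?thesis using that finJ cJ psubset_card_mono[of J] by (auto simp: p_def)
  qed
  moreover have "inj_on p {0..<k}"
    using pick_p f by (intro inj_onI) (metis atLeastLessThan_iff bij_betw_def inj_onD lessThan_iff)
  ultimately have perm: "p permutes {0..<k}"
    by (intro inj_imp_permutes) (auto simp: p_def)
  have rows: "{i. i < m \<and> i \<in> {..<m}} = {..<m}" and cols: "{j. j < n \<and> j \<in> J} = J"
    using J by auto
  have pick_id: "pick {..<m} i = i" if "i < m" for i
  proof -
    have "{a \<in> {..<m}. a < i} = {..<i}" using that by auto
    thus ?thesis using pick_card_in_set[of i "{..<m}"] that by simp
  qed
  have sub: "submatrix A {..<m} J = select_cols A k (pick J)"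
    using A cJ rows cols by (intro eq_matI) (auto simp: submatrix_def select_cols_def pick_id)
  have "select_cols A k f = select_cols A k (pick J \<circ> p)"
    using A by (intro eq_matI) (auto simp: select_cols_def pick_p)
  hence "det ((select_cols A k f)\<^sup>T * select_cols A k f)
      = det ((select_cols A k (pick J))\<^sup>T * select_cols A k (pick J))"
    using gram_det_permute_cols[OF A perm, of "pick J"] by simp
  thus ?thesis
    using vol_eq_sqrt_gram_det[OF _ km, of "select_cols A k (pick J)"] A by (simp add: sub)
qed

section \<open>Block factorizations and index exchange\<close>

lemma rank_le_rows:
  fixes A :: "'a :: field mat"
  assumes A: "A \<in> carrier_mat m n"
  shows "vec_space.rank m A \<le> m"
proof -
  interpret vec_space "TYPE('a)" m .
  obtain S where S: "maximal S (\<lambda>T. T \<subseteq> set (cols A) \<and> lin_indpt T)"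
    using maximal_exists[of "\<lambda>T. T \<subseteq> set (cols A) \<and> lin_indpt T" "card (set (cols A))" "{}"]
    by (meson List.finite_set card_mono empty_iff empty_subsetI finite_lin_indpt2 rev_finite_subset)
  have "S \<subseteq> carrier_vec m" "lin_indpt S"
    using S A cols_dim[of A] unfolding maximal_def by auto
  hence "card S \<le> dim" using li_le_dim(2)[OF fin_dim] by simp
  thus ?thesis using rank_card_indpt[OF A S] dim_is_n by simp
qed

lemma orthonormal_cols_append:
  assumes Q1: "Q1 \<in> carrier_mat m k" and Q2: "Q2 \<in> carrier_mat m l"
    and orth: "orthonormal_cols (Q1 @\<^sub>c Q2)"
  shows "Q1\<^sup>T * Q1 = 1\<^sub>m k" "Q2\<^sup>T * Q2 = 1\<^sub>m l" "Q1\<^sup>T * Q2 = 0\<^sub>m k l"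
proof -
  have dim: "dim_col (Q1 @\<^sub>c Q2) = k + l" using Q1 Q2 by (simp add: append_cols_def)
  have col1: "col (Q1 @\<^sub>c Q2) a = col Q1 a" if "a < k" for a
    using that Q1 Q2 by (intro eq_vecI) (auto simp: append_cols_def)
  have col2: "col (Q1 @\<^sub>c Q2) (k + a) = col Q2 a" if "a < l" for a
    using that Q1 Q2 by (intro eq_vecI) (auto simp: append_cols_def)
  have o: "col (Q1 @\<^sub>c Q2) a \<bullet> col (Q1 @\<^sub>c Q2) b = (if a = b then 1 else 0)"
    if "a < k + l" "b < k + l" for a b
    using orth that unfolding orthonormal_cols_def dim by simp
  show "Q1\<^sup>T * Q1 = 1\<^sub>m k"
    using Q1 o col1 by (intro eq_matI) (auto, (metis trans_less_add1)+)
  show "Q2\<^sup>T * Q2 = 1\<^sub>m l"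
  proof (rule eq_matI, goal_cases)
    case (1 a b)
    thus ?case using Q2 o[of "k + a" "k + b"] col2 by auto
  qed (use Q2 in auto)
  show "Q1\<^sup>T * Q2 = 0\<^sub>m k l"
  proof (rule eq_matI, goal_cases)
    case (1 a b)
    thus ?case using Q1 Q2 o[of "a" "k + b"] col1 col2 by auto
  qed (use Q1 Q2 in auto)
qed

lemma append_cols_mult_block:
  assumes "Q1 \<in> carrier_mat m k" "Q2 \<in> carrier_mat m l" "R11 \<in> carrier_mat k k"
    "R12 \<in> carrier_mat k q" "R22 \<in> carrier_mat l q"
  shows "(Q1 @\<^sub>c Q2) * four_block_mat R11 R12 (0\<^sub>m l k) R22 = (Q1 * R11) @\<^sub>c (Q1 * R12 + Q2 * R22)"
proof -
  have "(Q1 @\<^sub>c Q2) * four_block_mat R11 R12 (0\<^sub>m l k) R22 =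
    four_block_mat (Q1 * R11 + Q2 * 0\<^sub>m l k) (Q1 * R12 + Q2 * R22)
      (0\<^sub>m 0 k * R11 + 0\<^sub>m 0 l * 0\<^sub>m l k) (0\<^sub>m 0 k * R12 + 0\<^sub>m 0 l * R22)"
    unfolding append_cols_def using assms
    by (subst mult_four_block_mat[of _ m k _ l _ 0 _ _ k _ q]) auto
  also have "\<dots> = (Q1 * R11) @\<^sub>c (Q1 * R12 + Q2 * R22)"
    unfolding append_cols_def using assms by simp
  finally show ?thesis .
qed

lemma col_append_cols:
  assumes "A \<in> carrier_mat m k" "B \<in> carrier_mat m l"
  shows "a < k \<Longrightarrow> col (A @\<^sub>c B) a = col A a" "a < l \<Longrightarrow> col (A @\<^sub>c B) (k + a) = col B a"
  using assms by (auto intro!: eq_vecI simp: append_cols_def)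

lemma the_mat_inverse:
  fixes R :: "'a :: field mat"
  assumes R: "R \<in> carrier_mat k k" and inv: "invertible_mat R"
  shows "the (mat_inverse R) \<in> carrier_mat k k" "R * the (mat_inverse R) = 1\<^sub>m k"
proof -
  obtain B where B: "R * B = 1\<^sub>m k" "B * R = 1\<^sub>m (dim_row B)"
    using inv R unfolding invertible_mat_def inverts_mat_def by auto
  have "dim_row B = k" "dim_col B = k"
    using arg_cong[OF B(1), of dim_col] arg_cong[OF B(2), of dim_col] R by auto
  hence "R \<in> Units (ring_mat TYPE('a) k ())"
    using R B unfolding Units_def by (auto simp: ring_mat_simps)
  hence "mat_inverse R \<noteq> None" using mat_inverse(1)[OF R, where b = "()"] by auto
  then obtain B where "mat_inverse R = Some B" by auto
  thus "the (mat_inverse R) \<in> carrier_mat k k" "R * the (mat_inverse R) = 1\<^sub>m k"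
    using mat_inverse(2)[OF R] by auto
qed

text \<open>In sets of equal size, removing and adding elements balance: at most one new element means
  at most one element lost.\<close>

lemma one_element_exchange:
  assumes J: "finite J" "finite J'" "card J' = card J" "card (J' - J) \<le> 1"
  obtains "J' = J" | x y where "x \<in> J" "y \<notin> J" "J' = insert y (J - {x})"
proof (cases "J' - J = {}")
  case True
  thus ?thesis using that(1) J card_subset_eq by blast
next
  case False
  have "card (J - J') = card (J' - J)" using J
    by (metis card_Diff_subset_Int card_Int_Diff Int_commute add_left_cancel finite_Int)
  moreover have "card (J' - J) = 1" using J False
    by (metis One_nat_def card_0_eq finite_Diff le_antisym not_less_eq_eq le_0_eq)
  ultimately obtain x y where "J - J' = {x}" "J' - J = {y}" by (metis card_1_singletonE)
  hence "x \<in> J" "y \<notin> J" "J' = insert y (J - {x})" by blast+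
  thus ?thesis by (rule that(2))
qed

section \<open>Local maximality of the volume\<close>

theorem theorem6p3:
  fixes A P Q1 Q2 R11 R12 R22 :: "real mat" and m n k :: nat and \<mu> \<nu> :: real
  assumes A: "A \<in> carrier_mat m n"
    and k: "1 \<le> k" "k \<le> vec_space.rank m A"
    and P: "permutation_matrix n P"
    and Q1: "Q1 \<in> carrier_mat m k"
    and Q2: "Q2 \<in> carrier_mat m (min m n - k)"
    and orth: "orthonormal_cols (Q1 @\<^sub>c Q2)"
    and R11: "R11 \<in> carrier_mat k k" "upper_triangular R11" "invertible_mat R11"
    and R12: "R12 \<in> carrier_mat k (n - k)"
    and R22: "R22 \<in> carrier_mat (min m n - k) (n - k)"
    and QR: "A * P = (Q1 @\<^sub>c Q2) * four_block_mat R11 R12 (0\<^sub>m (min m n - k) k) R22"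
    and params: "\<mu> \<ge> 1" "\<nu> \<ge> 1"
    and cond1: "sigma k A \<le> \<mu> * sigma k R11"
    and cond2: "spectral_norm R22 \<le> \<mu> * sigma (k + 1) A"
    and cond3: "max_norm (the (mat_inverse R11) * R12) \<le> \<nu>"
  shows "\<exists>\<gamma> \<le> sqrt (\<nu>\<^sup>2 + \<mu> ^ 4). local_max_vol \<gamma> A m k {..<m} (leading_cols k P)"
proof -
  obtain \<pi> where \<pi>: "\<pi> permutes {..<n}" and P_eq: "P = perm_mat n \<pi>"
    using P unfolding permutation_matrix_def by auto
  have km: "k \<le> m" using k rank_le_rows[OF A] by linarith
  have kn: "k \<le> n" using k vec_space.rank_le_nc[OF A] by linarith
  have \<pi>_less: "\<pi> j < n \<longleftrightarrow> j < n" for j using permutes_in_image[OF \<pi>, of j] by simp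
  have \<pi>_inj: "inj \<pi>" using permutes_inj[OF \<pi>] .
  define J where "J = \<pi> ` {..<k}"
  have J: "leading_cols k P = J" unfolding J_def P_eq by (rule leading_cols_perm_mat[OF \<pi> kn])
  have J_sub: "J \<subseteq> {..<n}"
  proof
    fix y assume "y \<in> J"
    then obtain a where "a < k" "y = \<pi> a" unfolding J_def by blast
    thus "y \<in> {..<n}" using \<pi>_less[of a] kn by simp
  qed
  have J_bij: "bij_betw \<pi> {..<k} J" unfolding J_def using \<pi>_inj by (meson bij_betw_imageI inj_on_subset subset_UNIV)
  have cardJ: "card J = k" using bij_betw_same_card[OF J_bij] by simp
  note o = orthonormal_cols_append[OF Q1 Q2 orth]
  \<comment> \<open>\<open>C\<close> holds the first \<open>k\<close> columns of \<open>A * P\<close> and \<open>F\<close> the others\<close>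
  define C where "C = Q1 * R11"
  define F where "F = Q1 * R12 + Q2 * R22"
  have C: "C \<in> carrier_mat m k" and F: "F \<in> carrier_mat m (n - k)"
    unfolding C_def F_def using Q1 Q2 R11 R12 R22 by auto
  have AP: "A * P = C @\<^sub>c F"
    unfolding QR C_def F_def by (rule append_cols_mult_block[OF Q1 Q2 R11(1) R12 R22])
  have colC: "col C a = col A (\<pi> a)" if "a < k" for a
    using col_mult_perm_mat[OF A \<pi>, of a] col_append_cols(1)[OF C F that] that kn unfolding P_eq[symmetric] AP by simp
  have colF: "col F a = col A (\<pi> (k + a))" if "a < n - k" for a
    using col_mult_perm_mat[OF A \<pi>, of "k + a"] col_append_cols(2)[OF C F that] that kn unfolding P_eq[symmetric] AP by simp
  have C_sel: "select_cols A k \<pi> = C"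
  proof (rule eq_matI, goal_cases)
    case (1 a b)
    have "\<pi> b < n" using 1 C kn by (simp add: \<pi>_less)
    thus ?case using 1 A C arg_cong[OF colC[of b], of "\<lambda>v. v $ a"] by (simp add: select_cols_def)
  qed (use A C in \<open>auto simp: select_cols_def\<close>)
  have CC: "C\<^sup>T * C = R11\<^sup>T * R11"
  proof -
    have "C\<^sup>T * C = R11\<^sup>T * (Q1\<^sup>T * (Q1 * R11))"
      unfolding C_def using Q1 R11 by (simp add: transpose_mult[of _ m k] assoc_mult_mat[of _ k k _ m _ k])
    also have "Q1\<^sup>T * (Q1 * R11) = R11"
      using Q1 R11 o(1) by (simp add: assoc_mult_mat[of _ k m _ k _ k, symmetric])
    finally show ?thesis .
  qed
  \<comment> \<open>singular values depend only on the Gram matrix and the two dimensions\<close>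
  have sC: "sigma k C = sigma k R11"
    using C R11 k km by (simp add: sigma_def sing_vals_def CC)
  \<comment> \<open>one factor \<open>\<mu>\<close> comes from the bound on \<open>R22\<close>, the other from the bound on \<open>\<sigma>\<^sub>k(A)\<close>\<close>
  have s_ratio: "spectral_norm R22 \<le> \<mu>\<^sup>2 * sigma k C"
  proof -
    have "sigma (k + 1) A \<le> sigma k A" using sigma_Suc_le[of k A] A k km kn by simp
    also have "\<dots> \<le> \<mu> * sigma k C" using cond1 sC by simp
    finally have "\<mu> * sigma (k + 1) A \<le> \<mu> * (\<mu> * sigma k C)" using params by (intro mult_left_mono) auto
    thus ?thesis using cond2 by (simp add: power2_eq_square mult.assoc)
  qed
  define \<gamma> where "\<gamma> = sqrt (\<nu>\<^sup>2 + \<mu> ^ 4)"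
  have \<gamma>: "\<gamma> > 1"
  proof -
    have "\<nu>\<^sup>2 \<ge> 1" "\<mu> ^ 4 \<ge> 1" using params by auto
    thus ?thesis unfolding \<gamma>_def by simp
  qed
  have volJ: "vol (submatrix A {..<m} J) = sqrt (det (C\<^sup>T * C))"
    unfolding C_sel[symmetric] by (rule vol_submatrix_eq_gram_det[OF A km J_sub J_bij])
  have main: "vol (submatrix A {..<m} J') \<le> \<gamma> * vol (submatrix A {..<m} J)"
    if J': "J' \<subseteq> {..<n}" "card J' = k" "card (J' - J) \<le> 1" for J'
  proof -
    have fin: "finite J" "finite J'" using J_sub J'(1) finite_subset by blast+
    consider "J' = J" | x y where "x \<in> J" "y \<notin> J" "J' = insert y (J - {x})"
      using one_element_exchange[OF fin _ J'(3)] J'(2) cardJ by metis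
    thus ?thesis
    proof cases
      case 1
      have "vol (submatrix A {..<m} J) \<ge> 0" unfolding volJ using gram_det_nonneg[OF C] by simp
      thus ?thesis using 1 \<gamma> by (simp add: mult_le_cancel_right1)
    next
      case (2 x y)
      obtain i where i: "i < k" "x = \<pi> i" using 2 unfolding J_def by auto
      have "y \<in> \<pi> ` {..<n}" using 2 J'(1) permutes_image[OF \<pi>] by auto
      then obtain l where l: "l < n" "y = \<pi> l" by auto
      have "\<not> l < k" using 2 l unfolding J_def by auto
      then obtain j where j: "j < n - k" "y = \<pi> (k + j)"
        using l by (metis add_diff_inverse_nat diff_less_mono not_less)
      define f where "f = \<pi>(i := y)"
      define u where "u = col (the (mat_inverse R11) * R12) j"
      define d where "d = col (Q2 * R22) j"
      note inv = the_mat_inverse[OF R11(1,3)]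
      have u: "u \<in> carrier_vec k" and d: "d \<in> carrier_vec m"
        unfolding u_def d_def using inv R12 R22 Q2 j by auto
      have Cu: "C *\<^sub>v u = col (Q1 * R12) j"
      proof -
        have "C *\<^sub>v u = col (C * (the (mat_inverse R11) * R12)) j"
          unfolding u_def using C inv R12 j by (intro col_mult2[symmetric]) auto
        also have "C * (the (mat_inverse R11) * R12) = Q1 * (R11 * the (mat_inverse R11) * R12)"
          unfolding C_def using Q1 R11 R12 inv(1)
          by (simp add: assoc_mult_mat[of _ k k _ k _ "n - k"] assoc_mult_mat[of _ m k _ k _ "n - k"])
        finally show ?thesis using inv(2) R12 by simp
      qed
      \<comment> \<open>the new column splits into its projection onto the column space of \<open>C\<close> and the rest\<close>
      have colFj: "col F j = C *\<^sub>v u + d"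
        unfolding Cu d_def F_def using Q1 Q2 R12 R22 j by (intro eq_vecI) auto
      have sel: "select_cols A k f = replace_col C (C *\<^sub>v u + d) i"
      proof (rule eq_matI, goal_cases)
        case (1 a b)
        hence ab: "a < m" "b < k" using C by (auto simp: replace_col_def)
        have "\<pi> b < n" "\<pi> (k + j) < n" using ab j kn by (simp_all add: \<pi>_less)
        thus ?case
          using ab A C F i j colFj[symmetric] arg_cong[OF colC[of b], of "\<lambda>v. v $ a"] arg_cong[OF colF[of j], of "\<lambda>v. v $ a"]
          by (auto simp: select_cols_def replace_col_def f_def)
      qed (use A C in \<open>auto simp: select_cols_def replace_col_def\<close>)
      have f_bij: "bij_betw f {..<k} J'"
      proof (rule bij_betw_imageI)
        have off: "f b = \<pi> b" if "b \<noteq> i" for b using that by (simp add: f_def)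
        have "{..<k} = insert i ({..<k} - {i})" using i by auto
        hence "f ` {..<k} = insert y (f ` ({..<k} - {i}))" by (metis f_def fun_upd_same image_insert)
        also have "f ` ({..<k} - {i}) = \<pi> ` ({..<k} - {i})" by (intro image_cong) (auto simp: off)
        also have "\<dots> = J - {x}" unfolding J_def i(2) using \<pi>_inj i by (auto simp: inj_eq)
        finally show f_img: "f ` {..<k} = J'" using 2 by simp
        show "inj_on f {..<k}" by (rule eq_card_imp_inj_on) (simp_all add: f_img J'(2))
      qed
      have orth_d: "C\<^sup>T *\<^sub>v d = 0\<^sub>v k"
      proof -
        have "C\<^sup>T *\<^sub>v d = col (C\<^sup>T * (Q2 * R22)) j"
          unfolding d_def using C Q2 R22 j by (intro col_mult2[symmetric]) auto
        also have "C\<^sup>T * (Q2 * R22) = R11\<^sup>T * (Q1\<^sup>T * Q2 * R22)"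
          unfolding C_def using Q1 R11 Q2 R22
          by (simp add: transpose_mult[of _ m k] assoc_mult_mat[of _ k k _ m _ "n - k"] assoc_mult_mat[of _ k m _ "min m n - k" _ "n - k"])
        also have "\<dots> = 0\<^sub>m k (n - k)" unfolding o(3) using R11 R22 by simp
        finally show ?thesis using j by simp
      qed
      have "d \<bullet> d = col R22 j \<bullet> col R22 j"
      proof -
        have "d = Q2 *\<^sub>v col R22 j" unfolding d_def using Q2 R22 j by (intro col_mult2) auto
        hence "d \<bullet> d = col R22 j \<bullet> ((Q2\<^sup>T * Q2) *\<^sub>v col R22 j)"
          using gram_quadratic_form[OF Q2, of "col R22 j" "col R22 j"] R22 j by auto
        thus ?thesis unfolding o(2) using R22 j by simp
      qed
      hence dd: "sqrt (d \<bullet> d) \<le> \<mu>\<^sup>2 * sigma k C"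
        using column_norm_le_spectral_norm[OF R22 j(1)] s_ratio by simp
      have "\<bar>u $ i\<bar> \<le> max_norm (the (mat_inverse R11) * R12)"
        using abs_entry_le_max_norm[of i "the (mat_inverse R11) * R12" j] inv(1) R12 i j by (simp add: u_def)
      hence ui: "\<bar>u $ i\<bar> \<le> \<nu>" using cond3 by simp
      have "vol (submatrix A {..<m} J') = sqrt (det ((select_cols A k f)\<^sup>T * select_cols A k f))"
        by (rule vol_submatrix_eq_gram_det[OF A km J'(1) f_bij])
      also have "\<dots> \<le> sqrt ((\<nu>\<^sup>2 + (\<mu>\<^sup>2)\<^sup>2) * det (C\<^sup>T * C))"
        unfolding sel using gram_det_replace_col_le[OF C km i(1) u d orth_d ui dd] by simp
      also have "\<dots> = \<gamma> * vol (submatrix A {..<m} J)"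
        unfolding volJ \<gamma>_def by (simp add: real_sqrt_mult flip: power_mult)
      finally show ?thesis .
    qed
  qed
  have "local_max_vol \<gamma> A m k {..<m} J"
    unfolding local_max_vol_def
  proof (intro conjI allI impI, goal_cases)
    case 1 show ?case by (rule \<gamma>)
    case 2 show ?case using A J_sub cardJ by (simp add: submatrix_idx_def)
    case (3 I' J')
    hence "I' = {..<m}" using A card_subset_eq[of "{..<m}" I'] by (auto simp: submatrix_idx_def)
    thus ?case using 3 main[of J'] A \<gamma> by (auto simp: submatrix_idx_def field_simps)
  qed
  thus ?thesis unfolding J \<gamma>_def by blast
qed

end
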